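(* Let $\rho$ be a density operator on $\mathbb{C}^2\otimes\mathbb{C}^2$, and let $c_{ij}=\mathrm{Tr}(\rho\,\sigma_i\otimes\sigma_j)$ for $i,j\in\{1,2,3\}$ be the entries of its correlation matrix. If $\rho$ is separable, then $$\sum_{i,j=1}^{3}c_{ij}^2\leq 1.$$
   Context: $\sigma_1,\sigma_2,\sigma_3$ are the Pauli matrices $\sigma_x,\sigma_y,\sigma_z$. A density operator is a positive semidefinite operator of trace one. Every density operator on $\mathbb{C}^2\otimes\mathbb{C}^2$ can be written $\rho=\frac14\bigl(\mathbf 1\otimes\mathbf 1+\mathbf a\cdot\boldsymbol\sigma\otimes\mathbf 1+\mathbf 1\otimes\mathbf b\cdot\boldsymbol\sigma+\sum_{ij}c_{ij}\,\sigma_i\otimes\sigma_j\bigr)$, where $a_i=\mathrm{Tr}(\rho\,\sigma_i\otimes\mathbf 1)$, $b_i=\mathrm{Tr}(\rho\,\mathbf 1\otimes\sigma_i)$ and $c_{ij}=\mathrm{Tr}(\rho\,\sigma_i\otimes\sigma_j)$ are real. $\rho$ is separable if $\rho=\sum_k\lambda_k\,\rho^1_k\otimes\rho^2_k$ for some finite collection of $\lambda_k\ge 0$ with $\sum_k\lambda_k=1$ and density operators $\rho^1_k,\rho^2_k$ on $\mathbb{C}^2$; otherwise it is entangled. *)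

theory Defs
  imports "HOL-Analysis.Analysis"
begin

text \<open>
  Operators on \<open>\<complex>\<^sup>n\<close> are square complex matrices; the space \<open>\<complex>\<^sup>2 \<otimes> \<complex>\<^sup>2\<close> has its
  product basis indexed by the type \<open>2 \<times> 2\<close>.
\<close>

definition conj_transpose :: "complex ^ 'n ^ 'm \<Rightarrow> complex ^ 'm ^ 'n" where
  "conj_transpose A = map_matrix cnj (transpose A)"

definition hermitian :: "complex ^ 'n ^ 'n \<Rightarrow> bool" where
  "hermitian A \<longleftrightarrow> conj_transpose A = A"

definition cinner_vec :: "complex ^ 'n \<Rightarrow> complex ^ 'n \<Rightarrow> complex" where
  "cinner_vec x y = (\<Sum>i\<in>UNIV. cnj (x $ i) * y $ i)"

text \<open>For a Hermitian matrix the quadratic form is real, so taking \<open>Re\<close> loses nothing.\<close>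

definition pos_semidef :: "complex ^ 'n ^ 'n \<Rightarrow> bool" where
  "pos_semidef A \<longleftrightarrow> hermitian A \<and> (\<forall>x. 0 \<le> Re (cinner_vec x (A *v x)))"

definition density_operator :: "complex ^ 'n ^ 'n \<Rightarrow> bool" where
  "density_operator \<rho> \<longleftrightarrow> pos_semidef \<rho> \<and> trace \<rho> = 1"

definition tensor_op ::
    "complex ^ 'n ^ 'n \<Rightarrow> complex ^ 'm ^ 'm \<Rightarrow> complex ^ ('n \<times> 'm) ^ ('n \<times> 'm)"
    (infixl \<open>\<otimes>\<^sub>o\<close> 75) where
  "A \<otimes>\<^sub>o B = (\<chi> p q. A $ fst p $ fst q * B $ snd p $ snd q)"

definition separable :: "complex ^ (2 \<times> 2) ^ (2 \<times> 2) \<Rightarrow> bool" where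
  "separable \<rho> \<longleftrightarrow>
    (\<exists>(n::nat) (l :: nat \<Rightarrow> real) (\<rho>1 :: nat \<Rightarrow> complex ^ 2 ^ 2) (\<rho>2 :: nat \<Rightarrow> complex ^ 2 ^ 2).
      (\<forall>k<n. 0 \<le> l k \<and> density_operator (\<rho>1 k) \<and> density_operator (\<rho>2 k)) \<and>
      (\<Sum>k<n. l k) = 1 \<and>
      \<rho> = (\<Sum>k<n. l k *\<^sub>R (\<rho>1 k \<otimes>\<^sub>o \<rho>2 k)))"

text \<open>The index type \<open>3\<close> has exactly the elements \<open>1\<close>, \<open>2\<close> and \<open>3\<close> (with \<open>3 = 0\<close>).\<close>

definition pauli :: "3 \<Rightarrow> complex ^ 2 ^ 2" where
  "pauli i =
    (if i = 1 then vector [vector [0, 1], vector [1, 0]]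
     else if i = 2 then vector [vector [0, - \<i>], vector [\<i>, 0]]
     else vector [vector [1, 0], vector [0, - 1]])"

text \<open>
  The trace below is real whenever \<open>\<rho>\<close> is Hermitian; see \<open>of_real_correlation\<close>.
\<close>

definition correlation :: "complex ^ (2 \<times> 2) ^ (2 \<times> 2) \<Rightarrow> 3 \<Rightarrow> 3 \<Rightarrow> real" where
  "correlation \<rho> i j = Re (trace (\<rho> ** (pauli i \<otimes>\<^sub>o pauli j)))"

lemma hermitian_nth: "hermitian A \<longleftrightarrow> (\<forall>i j. cnj (A $ j $ i) = A $ i $ j)"
  by (simp add: hermitian_def conj_transpose_def map_matrix_def transpose_def vec_eq_iff)

lemma hermitian_pauli: "hermitian (pauli i)"
  by (auto simp: hermitian_nth pauli_def forall_2)

lemma hermitian_tensor_op: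
  assumes "hermitian A" "hermitian B"
  shows "hermitian (A \<otimes>\<^sub>o B)"
  using assms by (simp add: hermitian_nth tensor_op_def)

lemma trace_hermitian_mult_real:
  assumes "hermitian A" "hermitian B"
  shows "trace (A ** B) \<in> \<real>"
proof -
  have "cnj (trace (A ** B)) = (\<Sum>i\<in>UNIV. \<Sum>k\<in>UNIV. A $ k $ i * B $ i $ k)"
    using assms by (simp add: hermitian_nth trace_def matrix_matrix_mult_def)
  also have "\<dots> = trace (A ** B)"
    unfolding trace_def matrix_matrix_mult_def by (subst sum.swap) simp
  finally show ?thesis
    by (simp add: Reals_cnj_iff)
qed

lemma of_real_correlation:
  assumes "density_operator \<rho>"
  shows "complex_of_real (correlation \<rho> i j) = trace (\<rho> ** (pauli i \<otimes>\<^sub>o pauli j))"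
  unfolding correlation_def
  using assms
  by (intro of_real_Re trace_hermitian_mult_real hermitian_tensor_op hermitian_pauli)
     (simp add: density_operator_def pos_semidef_def)

end

theory Submission
  imports Defs
begin

text \<open>
  The correlation matrix of a product state is the outer product \<open>u v\<^sup>T\<close> of the two Bloch
  vectors, whose Frobenius norm is \<open>\<bar>u\<bar> \<bar>v\<bar> \<le> 1\<close>. The correlation matrix is linear in the state, so
  that of a separable state is a convex combination of such outer products, and the unit ball of
  the Frobenius norm is convex.
\<close>

lemma trace_tensor_op: "trace (A \<otimes>\<^sub>o B) = trace A * trace B"
proof -
  have "trace (A \<otimes>\<^sub>o B) = (\<Sum>p\<in>UNIV \<times> UNIV. A $ fst p $ fst p * B $ snd p $ snd p)"
    by (simp add: trace_def tensor_op_def)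
  also have "\<dots> = trace A * trace B"
    by (simp only: sum.cartesian_product' trace_def sum_product fst_conv snd_conv)
  finally show ?thesis .
qed

lemma tensor_op_mult: "(A \<otimes>\<^sub>o B) ** (C \<otimes>\<^sub>o D) = (A ** C) \<otimes>\<^sub>o (B ** D)"
proof -
  \<comment> \<open>The contracted index is a pair, so summing over it is a double sum, which
    factors into an entry of \<open>A ** C\<close> times an entry of \<open>B ** D\<close>.\<close>
  have "(\<Sum>r\<in>UNIV. (A $ i $ fst r * B $ j $ snd r) * (C $ fst r $ k * D $ snd r $ l)) =
      (\<Sum>r\<in>UNIV. A $ i $ r * C $ r $ k) * (\<Sum>r\<in>UNIV. B $ j $ r * D $ r $ l)" for i j k l
    by (simp only: UNIV_Times_UNIV[symmetric] sum.cartesian_product' sum_product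
        fst_conv snd_conv) (simp add: mult_ac)
  then show ?thesis
    by (simp add: vec_eq_iff tensor_op_def matrix_matrix_mult_def)
qed

text \<open>Since \<open>correlation\<close> takes a real part, linearity holds over the reals,
  which suffices for the real weights of a separable decomposition.\<close>

lemma linear_correlation: "linear (\<lambda>\<rho>. \<chi> i j. correlation \<rho> i j)"
proof (rule linearI)
  show "(\<chi> i j. correlation (A + B) i j) =
      (\<chi> i j. correlation A i j) + (\<chi> i j. correlation B i j)" for A B
    by (simp add: vec_eq_iff correlation_def trace_def matrix_matrix_mult_def
        distrib_right sum.distrib)
  have "trace ((r *\<^sub>R A) ** B) = r *\<^sub>R trace (A ** B)" for r and A B :: "complex ^ (2 \<times> 2) ^ (2 \<times> 2)"
    by (simp add: trace_def matrix_matrix_mult_def scaleR_right.sum)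
  then show "(\<chi> i j. correlation (r *\<^sub>R A) i j) = r *\<^sub>R (\<chi> i j. correlation A i j)" for r A
    by (simp add: vec_eq_iff correlation_def)
qed

definition bloch_vector :: "complex ^ 2 ^ 2 \<Rightarrow> real ^ 3" where
  "bloch_vector A = (\<chi> i. Re (trace (A ** pauli i)))"

text \<open>The trace factors over the tensor product. As \<open>Re\<close> is not multiplicative in
  general, hermiticity is what makes both factors real.\<close>

lemma correlation_tensor_op:
  assumes "hermitian A" "hermitian B"
  shows "correlation (A \<otimes>\<^sub>o B) i j = bloch_vector A $ i * bloch_vector B $ j"
proof -
  have "trace (A ** pauli i) \<in> \<real>" "trace (B ** pauli j) \<in> \<real>"
    using assms by (auto intro: trace_hermitian_mult_real hermitian_pauli)
  then show ?thesis
    by (auto simp: correlation_def bloch_vector_def tensor_op_mult trace_tensor_op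
        elim!: Reals_cases)
qed

text \<open>Row i is v scaled by the i-th entry of u, so the factor \<open>norm v\<close> comes out
  of the outer Euclidean norm.\<close>

lemma norm_outer_product:
  fixes u :: "real ^ 'n" and v :: "real ^ 'm"
  shows "norm (\<chi> i j. u $ i * v $ j) = norm u * norm v"
proof -
  have "norm ((\<chi> i j. u $ i * v $ j) $ i) = norm v * norm (u $ i)" for i
  proof -
    have "(\<chi> i j. u $ i * v $ j) $ i = (u $ i) *\<^sub>R v"
      by (simp add: vec_eq_iff)
    then show ?thesis by simp
  qed
  then show ?thesis
    by (simp only: norm_vec_def L2_set_right_distrib[symmetric] norm_ge_zero L2_set_nonneg)
       (simp add: mult.commute)
qed

text \<open>For a Hermitian 2 by 2 matrix the squared Bloch length is (tr A)^2 - 4 det A. Here the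
  trace is 1, and positivity gives det A \<ge> 0.\<close>

lemma norm_bloch_vector_le_1:
  assumes "density_operator A"
  shows "norm (bloch_vector A) \<le> 1"
proof -
  have herm: "\<And>i j. cnj (A $ j $ i) = A $ i $ j"
    and psd: "\<And>x. 0 \<le> Re (cinner_vec x (A *v x))"
    and tr: "trace A = 1"
    using assms by (auto simp: density_operator_def pos_semidef_def hermitian_nth)
  define a d p q where "a = Re (A $ 1 $ 1)" and "d = Re (A $ 2 $ 2)"
    and "p = Re (A $ 1 $ 2)" and "q = Im (A $ 1 $ 2)"
  have A11: "A $ 1 $ 1 = Complex a 0" and A22: "A $ 2 $ 2 = Complex d 0"
    using herm[of 1 1] herm[of 2 2] by (auto simp: complex_eq_iff a_def d_def)
  have A12: "A $ 1 $ 2 = Complex p q" and A21: "A $ 2 $ 1 = Complex p (- q)"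
    using herm[of 1 2] by (auto simp: complex_eq_iff p_def q_def)
  have ad: "a + d = 1"
    using tr by (simp add: trace_def sum_2 A11 A22 complex_eq_iff)
  \<comment> \<open>The test vectors are the columns of the adjugate of \<open>A\<close>.\<close>
  have "0 \<le> a * (a * d - p\<^sup>2 - q\<^sup>2)"
    using psd[of "vector [- Complex p q, Complex a 0]"]
    by (simp add: cinner_vec_def matrix_vector_mult_def sum_2 A11 A12 A21 A22
        algebra_simps power2_eq_square)
  moreover have "0 \<le> d * (a * d - p\<^sup>2 - q\<^sup>2)"
    using psd[of "vector [Complex d 0, - Complex p (- q)]"]
    by (simp add: cinner_vec_def matrix_vector_mult_def sum_2 A11 A12 A21 A22
        algebra_simps power2_eq_square)
  \<comment> \<open>Each inequality alone fixes the sign of the determinant only if its diagonal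
    entry is nonzero. Adding them gives the weight a + d = 1 and avoids a case split.\<close>
  ultimately have "0 \<le> (a + d) * (a * d - p\<^sup>2 - q\<^sup>2)"
    by (simp add: distrib_right)
  then have det: "0 \<le> a * d - p\<^sup>2 - q\<^sup>2"
    by (simp add: ad)
  \<comment> \<open>The Bloch coordinates are 2p, -2q and a - d.\<close>
  have "(norm (bloch_vector A))\<^sup>2 = (2 * p)\<^sup>2 + (2 * q)\<^sup>2 + (a - d)\<^sup>2"
    by (simp add: norm_vec_def L2_set_def sum_3 bloch_vector_def pauli_def trace_def
        matrix_matrix_mult_def sum_2 A11 A12 A21 A22 power2_eq_square)
  also have "\<dots> = (a + d)\<^sup>2 - 4 * (a * d - p\<^sup>2 - q\<^sup>2)"
    by (simp add: power2_eq_square algebra_simps)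
  also have "\<dots> \<le> 1\<^sup>2"
    using det by (simp add: ad)
  finally show ?thesis
    by (rule power2_le_imp_le) simp
qed

theorem proposition5:
  fixes \<rho> :: "complex ^ (2 \<times> 2) ^ (2 \<times> 2)"
  assumes "density_operator \<rho>"
    and "separable \<rho>"
  shows "(\<Sum>i\<in>UNIV. \<Sum>j\<in>UNIV. (correlation \<rho> i j)\<^sup>2) \<le> 1"
proof -
  \<comment> \<open>The norm on \<open>real ^ 3 ^ 3\<close> is the Euclidean norm of the row norms,
    that is, the Frobenius norm, whose square is the sum to be bounded.\<close>
  let ?C = "\<lambda>\<rho>. (\<chi> i j. correlation \<rho> i j) :: real ^ 3 ^ 3"
  from \<open>separable \<rho>\<close> obtain n :: nat and l :: "nat \<Rightarrow> real" and A B :: "nat \<Rightarrow> complex ^ 2 ^ 2"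
    where l: "\<And>k. k < n \<Longrightarrow> 0 \<le> l k"
      and A: "\<And>k. k < n \<Longrightarrow> density_operator (A k)"
      and B: "\<And>k. k < n \<Longrightarrow> density_operator (B k)"
      and l_sum: "(\<Sum>k<n. l k) = 1"
      and \<rho>: "\<rho> = (\<Sum>k<n. l k *\<^sub>R (A k \<otimes>\<^sub>o B k))"
    unfolding separable_def by blast
  have prod_le: "norm (?C (A k \<otimes>\<^sub>o B k)) \<le> 1" if "k < n" for k
  proof -
    have "hermitian (A k)" "hermitian (B k)"
      using A[OF that] B[OF that] by (auto simp: density_operator_def pos_semidef_def)
    then have "norm (?C (A k \<otimes>\<^sub>o B k)) = norm (bloch_vector (A k)) * norm (bloch_vector (B k))"
      by (simp add: correlation_tensor_op norm_outer_product)
    also have "\<dots> \<le> 1"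
      using A[OF that] B[OF that] by (simp add: mult_le_one norm_bloch_vector_le_1)
    finally show ?thesis .
  qed
  have "?C \<rho> = (\<Sum>k<n. l k *\<^sub>R ?C (A k \<otimes>\<^sub>o B k))"
    unfolding \<rho>
    by (simp add: linear_sum[OF linear_correlation] linear_scale[OF linear_correlation])
  \<comment> \<open>Triangle inequality: by \<open>prod_le\<close> and nonnegativity of the weights,
    the k-th term has norm at most \<open>l k\<close>.\<close>
  also have "norm \<dots> \<le> (\<Sum>k<n. l k)"
    using l prod_le by (intro sum_norm_le) (simp add: mult_left_le)
  finally have "(norm (?C \<rho>))\<^sup>2 \<le> 1"
    by (simp add: l_sum power_le_one)
  moreover have "(norm (?C \<rho>))\<^sup>2 = (\<Sum>i\<in>UNIV. \<Sum>j\<in>UNIV. (correlation \<rho> i j)\<^sup>2)"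
    by (simp add: norm_vec_def L2_set_def sum_nonneg)
  ultimately show ?thesis
    by simp
qed

end
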